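(* Let $A$ be an associative algebra and $M$ an $A$-bimodule. A linear map $P:M\to A$ is a relative averaging operator if and only if the map $\mathcal N_P:A\oplus M\to A\oplus M$, $\mathcal N_P((a,u))=(P(u),0)$, is a Nijenhuis operator on the diassociative algebra $A\oplus_{\mathrm{Diass}}M$.
   Context: Vector spaces are over a field of characteristic $0$; associative algebras are not assumed unital. A relative averaging operator is a linear map $P:M\to A$ with $P(u)\cdot P(v)=P(P(u)\cdot_Mv)=P(u\cdot_MP(v))$ for all $u,v\in M$, where $\cdot_M$ denotes both the left and right $A$-actions on $M$. A diassociative algebra is a vector space $D$ with bilinear operations $\dashv,\vdash$ satisfying $(a\dashv b)\dashv c=a\dashv(b\dashv c)=a\dashv(b\vdash c)$, $(a\vdash b)\dashv c=a\vdash(b\dashv c)$, $(a\dashv b)\vdash c=(a\vdash b)\vdash c=a\vdash(b\vdash c)$. $A\oplus_{\mathrm{Diass}}M$ is the vector space $A\oplus M$ with the diassociative operations $(a,u)\dashv(b,v)=(a\cdot b,u\cdot_Mb)$ and $(a,u)\vdash(b,v)=(a\cdot b,a\cdot_Mv)$. A Nijenhuis operator on a diassociative algebra $D$ is a linear map $\mathcal N:D\to D$ such that for all $a,b\in D$: $\mathcal N(a)\dashv\mathcal N(b)=\mathcal N(\mathcal N(a)\dashv b+a\dashv\mathcal N(b)-\mathcal N(a\dashv b))$ and $\mathcal N(a)\vdash\mathcal N(b)=\mathcal N(\mathcal N(a)\vdash b+a\vdash\mathcal N(b)-\mathcal N(a\vdash b))$. *)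

theory Defs
  imports "HOL-Analysis.Product_Vector"
begin

definition bilinear_map ::
  "('k::field \<Rightarrow> 'a::ab_group_add \<Rightarrow> 'a) \<Rightarrow> ('k \<Rightarrow> 'b::ab_group_add \<Rightarrow> 'b) \<Rightarrow>
   ('k \<Rightarrow> 'c::ab_group_add \<Rightarrow> 'c) \<Rightarrow> ('a \<Rightarrow> 'b \<Rightarrow> 'c) \<Rightarrow> bool"
  where "bilinear_map s1 s2 s3 f \<longleftrightarrow>
    (\<forall>x. Vector_Spaces.linear s2 s3 (\<lambda>y. f x y)) \<and> (\<forall>y. Vector_Spaces.linear s1 s3 (\<lambda>x. f x y))"

text \<open>An algebra is a whole type with explicit scalar multiplication and product; no unit is
  required, and accordingly bimodules carry no unit axiom.\<close>

locale assoc_algebra = vector_space scaleA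
  for scaleA :: "'k::field \<Rightarrow> 'a::ab_group_add \<Rightarrow> 'a" +
  fixes mult :: "'a \<Rightarrow> 'a \<Rightarrow> 'a"
  assumes mult_bilinear: "bilinear_map scaleA scaleA scaleA mult"
    and mult_assoc: "mult (mult a b) c = mult a (mult b c)"

locale alg_bimodule =
  A: assoc_algebra scaleA mult + M: vector_space scaleM
  for scaleA :: "'k::field \<Rightarrow> 'a::ab_group_add \<Rightarrow> 'a"
    and mult :: "'a \<Rightarrow> 'a \<Rightarrow> 'a"
    and scaleM :: "'k \<Rightarrow> 'm::ab_group_add \<Rightarrow> 'm" +
  fixes lact :: "'a \<Rightarrow> 'm \<Rightarrow> 'm"
    and ract :: "'m \<Rightarrow> 'a \<Rightarrow> 'm"
  assumes lact_bilinear: "bilinear_map scaleA scaleM scaleM lact"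
    and ract_bilinear: "bilinear_map scaleM scaleA scaleM ract"
    and lact_mult: "lact (mult a b) u = lact a (lact b u)"
    and ract_mult: "ract u (mult a b) = ract (ract u a) b"
    and lact_ract: "ract (lact a u) b = lact a (ract u b)"

locale relative_averaging_operator =
  alg_bimodule scaleA mult scaleM lact ract + Vector_Spaces.linear scaleM scaleA P
  for scaleA :: "'k::field \<Rightarrow> 'a::ab_group_add \<Rightarrow> 'a"
    and mult :: "'a \<Rightarrow> 'a \<Rightarrow> 'a"
    and scaleM :: "'k \<Rightarrow> 'm::ab_group_add \<Rightarrow> 'm"
    and lact :: "'a \<Rightarrow> 'm \<Rightarrow> 'm"
    and ract :: "'m \<Rightarrow> 'a \<Rightarrow> 'm"
    and P :: "'m \<Rightarrow> 'a" +
  assumes averaging_left: "mult (P u) (P v) = P (lact (P u) v)"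
    and averaging_right: "mult (P u) (P v) = P (ract u (P v))"

text \<open>The operations \<open>ldash\<close> and \<open>rdash\<close> are written \<open>\<stileturn>\<close> and \<open>\<turnstile>\<close> respectively.\<close>

locale diassociative_algebra = vector_space scaleD
  for scaleD :: "'k::field \<Rightarrow> 'd::ab_group_add \<Rightarrow> 'd" +
  fixes ldash :: "'d \<Rightarrow> 'd \<Rightarrow> 'd" (infixl \<open>\<stileturn>\<close> 70)
    and rdash :: "'d \<Rightarrow> 'd \<Rightarrow> 'd" (infixl \<open>\<turnstile>\<close> 70)
  assumes ldash_bilinear: "bilinear_map scaleD scaleD scaleD (\<stileturn>)"
    and rdash_bilinear: "bilinear_map scaleD scaleD scaleD (\<turnstile>)"
    and ldash_assoc: "(a \<stileturn> b) \<stileturn> c = a \<stileturn> (b \<stileturn> c)"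
    and ldash_bar: "a \<stileturn> (b \<stileturn> c) = a \<stileturn> (b \<turnstile> c)"
    and inner_assoc: "(a \<turnstile> b) \<stileturn> c = a \<turnstile> (b \<stileturn> c)"
    and rdash_bar: "(a \<stileturn> b) \<turnstile> c = (a \<turnstile> b) \<turnstile> c"
    and rdash_assoc: "(a \<turnstile> b) \<turnstile> c = a \<turnstile> (b \<turnstile> c)"

locale nijenhuis_operator =
  diassociative_algebra scaleD ldash rdash + Vector_Spaces.linear scaleD scaleD N
  for scaleD :: "'k::field \<Rightarrow> 'd::ab_group_add \<Rightarrow> 'd"
    and ldash :: "'d \<Rightarrow> 'd \<Rightarrow> 'd" (infixl \<open>\<stileturn>\<close> 70)
    and rdash :: "'d \<Rightarrow> 'd \<Rightarrow> 'd" (infixl \<open>\<turnstile>\<close> 70)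
    and N :: "'d \<Rightarrow> 'd" +
  assumes nijenhuis_ldash: "N a \<stileturn> N b = N (N a \<stileturn> b + a \<stileturn> N b - N (a \<stileturn> b))"
    and nijenhuis_rdash: "N a \<turnstile> N b = N (N a \<turnstile> b + a \<turnstile> N b - N (a \<turnstile> b))"

text \<open>The vector space \<open>A \<oplus> M\<close> is the product type with scalar multiplication
  \<^const>\<open>module_prod.scale\<close>; the following are the operations of \<open>A \<oplus>\<^sub>D\<^sub>i\<^sub>a\<^sub>s\<^sub>s M\<close>.\<close>

definition diass_ldash ::
  "('a \<Rightarrow> 'a \<Rightarrow> 'a) \<Rightarrow> ('m \<Rightarrow> 'a \<Rightarrow> 'm) \<Rightarrow> 'a \<times> 'm \<Rightarrow> 'a \<times> 'm \<Rightarrow> 'a \<times> 'm"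
  where "diass_ldash mult ract = (\<lambda>(a, u) (b, v). (mult a b, ract u b))"

definition diass_rdash ::
  "('a \<Rightarrow> 'a \<Rightarrow> 'a) \<Rightarrow> ('a \<Rightarrow> 'm \<Rightarrow> 'm) \<Rightarrow> 'a \<times> 'm \<Rightarrow> 'a \<times> 'm \<Rightarrow> 'a \<times> 'm"
  where "diass_rdash mult lact = (\<lambda>(a, u) (b, v). (mult a b, lact a v))"

definition lift_op :: "('m \<Rightarrow> 'a) \<Rightarrow> 'a \<times> 'm \<Rightarrow> 'a \<times> 'm::zero"
  where "lift_op P = (\<lambda>(a, u). (P u, 0))"

lemma (in alg_bimodule) diassociative_algebra_sum:
  "diassociative_algebra (module_prod.scale scaleA scaleM)
     (diass_ldash mult ract) (diass_rdash mult lact)"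
proof -
  interpret p: vector_space_prod scaleA scaleM by unfold_locales
  have sc: "p.scale c (a, u) = (scaleA c a, scaleM c u)" for c a u
    by (simp add: p.scale_def)
  have vs: "vector_space p.scale" by unfold_locales
  note bil = A.mult_bilinear lact_bilinear ract_bilinear
  show ?thesis
    using bil
    unfolding diassociative_algebra_def diassociative_algebra_axioms_def
    by (auto simp: vs bilinear_map_def Vector_Spaces.linear_iff sc diass_ldash_def diass_rdash_def
        A.mult_assoc lact_mult ract_mult lact_ract)
qed

end

theory Submission
  imports Defs
begin

text \<open>\<open>lift_op P\<close> sees only the M-component of its argument and returns a value
  with M-component 0. Hence in a Nijenhuis identity for \<open>(a, u)\<close> and
  \<open>(b, v)\<close> all A-components inside the outer operator are lost, the doubly lifted term
  vanishes, and one mixed product keeps an M-component: \<open>ract u (P v)\<close> for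
  \<stileturn>, \<open>lact (P u) v\<close> for \<turnstile>. Each identity is thus exactly one half
  of the averaging condition, as the two iff lemmas state.\<close>

context alg_bimodule
begin

lemma lact_zero [simp]: "lact a 0 = 0"
proof -
  interpret l: Vector_Spaces.linear scaleM scaleM "lact a"
    using lact_bilinear by (simp add: bilinear_map_def)
  show ?thesis by (rule l.zero)
qed

lemma ract_zero [simp]: "ract 0 b = 0"
proof -
  interpret r: Vector_Spaces.linear scaleM scaleM "\<lambda>u. ract u b"
    using ract_bilinear by (simp add: bilinear_map_def)
  show ?thesis by (rule r.zero)
qed

lemma linear_lift_op:
  assumes "Vector_Spaces.linear scaleM scaleA P"
  shows "Vector_Spaces.linear (module_prod.scale scaleA scaleM)
    (module_prod.scale scaleA scaleM) (lift_op P)"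
proof -
  interpret p: vector_space_prod scaleA scaleM by unfold_locales
  interpret P: Vector_Spaces.linear scaleM scaleA P by fact
  have "vector_space p.scale" by unfold_locales
  then show ?thesis
    by (auto simp: Vector_Spaces.linear_iff lift_op_def p.scale_def P.add P.scale)
qed

text \<open>The M-component of \<stileturn> comes from its left factor, so a lifted left factor
  contributes \<open>ract 0 _ = 0\<close> and only the lifted right factor leaves a trace. The
  elements a and b drop out.\<close>

lemma lift_op_nijenhuis_ldash_iff:
  "diass_ldash mult ract (lift_op P (a, u)) (lift_op P (b, v)) =
     lift_op P (diass_ldash mult ract (lift_op P (a, u)) (b, v)
       + diass_ldash mult ract (a, u) (lift_op P (b, v))
       - lift_op P (diass_ldash mult ract (a, u) (b, v))) \<longleftrightarrow>
   mult (P u) (P v) = P (ract u (P v))"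
  by (simp add: diass_ldash_def lift_op_def)

text \<open>Mirror image: \<turnstile> takes its M-component from the right factor, so
  \<open>lact_zero\<close> removes the term in which that factor is lifted.\<close>

lemma lift_op_nijenhuis_rdash_iff:
  "diass_rdash mult lact (lift_op P (a, u)) (lift_op P (b, v)) =
     lift_op P (diass_rdash mult lact (lift_op P (a, u)) (b, v)
       + diass_rdash mult lact (a, u) (lift_op P (b, v))
       - lift_op P (diass_rdash mult lact (a, u) (b, v))) \<longleftrightarrow>
   mult (P u) (P v) = P (lact (P u) v)"
  by (simp add: diass_rdash_def lift_op_def)

end

theorem proposition3p13:
  fixes scaleA :: "'k::field_char_0 \<Rightarrow> 'a::ab_group_add \<Rightarrow> 'a"
    and mult :: "'a \<Rightarrow> 'a \<Rightarrow> 'a"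
    and scaleM :: "'k \<Rightarrow> 'm::ab_group_add \<Rightarrow> 'm"
    and lact :: "'a \<Rightarrow> 'm \<Rightarrow> 'm"
    and ract :: "'m \<Rightarrow> 'a \<Rightarrow> 'm"
    and P :: "'m \<Rightarrow> 'a"
  assumes "assoc_algebra scaleA mult"
    and "alg_bimodule scaleA mult scaleM lact ract"
    and "Vector_Spaces.linear scaleM scaleA P"
  shows "relative_averaging_operator scaleA mult scaleM lact ract P \<longleftrightarrow>
    nijenhuis_operator (module_prod.scale scaleA scaleM)
      (diass_ldash mult ract) (diass_rdash mult lact) (lift_op P)"
proof -
  interpret alg_bimodule scaleA mult scaleM lact ract by fact
  show ?thesis
    unfolding relative_averaging_operator_def relative_averaging_operator_axioms_def
      nijenhuis_operator_def nijenhuis_operator_axioms_def split_paired_all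
      lift_op_nijenhuis_ldash_iff lift_op_nijenhuis_rdash_iff
    \<comment> \<open>These facts settle the structural conjuncts on both sides; what remains are
      the identities, compared componentwise on pairs.\<close>
    using assms diassociative_algebra_sum linear_lift_op[OF assms(3)]
    by (auto simp: lift_op_nijenhuis_ldash_iff lift_op_nijenhuis_rdash_iff)
qed

end
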